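(* Let $G$ be a bridgeless cubic graph. Then $G$ has a Fulkerson covering if and only if $G$ has two compatible FR-triples.
   Context: A Fulkerson covering of $G$ is a family of $6$ perfect matchings $M_1,\dots,M_6$ of $G$ (not necessarily distinct) such that every edge of $G$ is contained in exactly two of them. An FR-triple is an ordered triple $\mathcal T=(M_1,M_2,M_3)$ of perfect matchings of $G$ with $M_1\cap M_2\cap M_3=\emptyset$; $T_i$ ($i=0,1,2$) denotes the set of edges contained in exactly $i$ of $M_1,M_2,M_3$, and $T'_i$ is defined similarly for an FR-triple $\mathcal T'$. Two FR-triples $\mathcal T,\mathcal T'$ are compatible if $T_0=T'_2$ and $T_2=T'_0$. *)

theory Defs
  imports Main
begin

text \<open>
  Undirected multigraphs: parallel edges are allowed, and a loop at \<open>v\<close> is an edge whose set of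
  ends is \<open>{v}\<close>. The classes of \<open>(adjacency G)\<^sup>*\<close> of vertices are the vertex sets of the
  connected components.
\<close>

record ('v, 'e) mgraph =
  verts :: "'v set"
  edges :: "'e set"
  ends :: "'e \<Rightarrow> 'v set"

definition finite_multigraph :: "('v, 'e) mgraph \<Rightarrow> bool" where
  "finite_multigraph G \<longleftrightarrow>
     finite (verts G) \<and> finite (edges G) \<and>
     (\<forall>e\<in>edges G. ends G e \<subseteq> verts G \<and> card (ends G e) \<in> {1, 2})"

text \<open>The second summand makes a loop contribute 2 to the degree.\<close>

definition degree :: "('v, 'e) mgraph \<Rightarrow> 'v \<Rightarrow> nat" where
  "degree G v = card {e \<in> edges G. v \<in> ends G e} + card {e \<in> edges G. ends G e = {v}}"

definition cubic :: "('v, 'e) mgraph \<Rightarrow> bool" where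
  "cubic G \<longleftrightarrow> (\<forall>v\<in>verts G. degree G v = 3)"

definition adjacency :: "('v, 'e) mgraph \<Rightarrow> 'v rel" where
  "adjacency G = {(u, v). \<exists>e\<in>edges G. ends G e = {u, v}}"

definition components :: "('v, 'e) mgraph \<Rightarrow> 'v set set" where
  "components G = verts G // (adjacency G)\<^sup>*"

definition delete_edge :: "('v, 'e) mgraph \<Rightarrow> 'e \<Rightarrow> ('v, 'e) mgraph" where
  "delete_edge G e = G\<lparr>edges := edges G - {e}\<rparr>"

definition bridge :: "('v, 'e) mgraph \<Rightarrow> 'e \<Rightarrow> bool" where
  "bridge G e \<longleftrightarrow> e \<in> edges G \<and> card (components G) < card (components (delete_edge G e))"

definition bridgeless :: "('v, 'e) mgraph \<Rightarrow> bool" where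
  "bridgeless G \<longleftrightarrow> (\<nexists>e. bridge G e)"

definition perfect_matching :: "('v, 'e) mgraph \<Rightarrow> 'e set \<Rightarrow> bool" where
  "perfect_matching G M \<longleftrightarrow>
     M \<subseteq> edges G \<and> (\<forall>e\<in>M. card (ends G e) = 2) \<and>
     (\<forall>v\<in>verts G. \<exists>!e. e \<in> M \<and> v \<in> ends G e)"

text \<open>Only the values of the family \<open>M\<close> at the indices \<open>1, \<dots>, 6\<close> matter.\<close>

definition fulkerson_covering :: "('v, 'e) mgraph \<Rightarrow> (nat \<Rightarrow> 'e set) \<Rightarrow> bool" where
  "fulkerson_covering G M \<longleftrightarrow>
     (\<forall>i\<in>{1..6}. perfect_matching G (M i)) \<and>
     (\<forall>e\<in>edges G. card {i \<in> {1..6}. e \<in> M i} = 2)"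

type_synonym 'e triple = "'e set \<times> 'e set \<times> 'e set"

definition fr_triple :: "('v, 'e) mgraph \<Rightarrow> 'e triple \<Rightarrow> bool" where
  "fr_triple G = (\<lambda>(M1, M2, M3).
     perfect_matching G M1 \<and> perfect_matching G M2 \<and> perfect_matching G M3 \<and>
     M1 \<inter> M2 \<inter> M3 = {})"

definition covered_exactly :: "('v, 'e) mgraph \<Rightarrow> 'e triple \<Rightarrow> nat \<Rightarrow> 'e set" where
  "covered_exactly G = (\<lambda>(M1, M2, M3) i.
     {e \<in> edges G. of_bool (e \<in> M1) + of_bool (e \<in> M2) + of_bool (e \<in> M3) = i})"

definition compatible :: "('v, 'e) mgraph \<Rightarrow> 'e triple \<Rightarrow> 'e triple \<Rightarrow> bool" where
  "compatible G T T' \<longleftrightarrow>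
     covered_exactly G T 0 = covered_exactly G T' 2 \<and>
     covered_exactly G T 2 = covered_exactly G T' 0"

end

theory Submission
  imports Defs
begin

text \<open>
  Split a family of six perfect matchings into two triples. An edge covered \<open>i\<close> times by the first
  triple and \<open>j\<close> times by the second is covered \<open>i + j\<close> times in total, and for \<open>i, j \<le> 2\<close> the
  equation \<open>i + j = 2\<close> says precisely that \<open>i = 0 \<longleftrightarrow> j = 2\<close> and \<open>i = 2 \<longleftrightarrow> j = 0\<close>.
\<close>

definition multiplicity :: "'e triple \<Rightarrow> 'e \<Rightarrow> nat" where
  "multiplicity = (\<lambda>(M1, M2, M3) e. of_bool (e \<in> M1) + of_bool (e \<in> M2) + of_bool (e \<in> M3))"

lemma covered_exactly_eq: "covered_exactly G T i = {e \<in> edges G. multiplicity T e = i}"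
  by (cases T) (simp add: covered_exactly_def multiplicity_def)

lemma card_six_indices:
  "card {i \<in> {1..6::nat}. e \<in> M i} =
     multiplicity (M 1, M 2, M 3) e + multiplicity (M 4, M 5, M 6) e"
proof -
  have "{1..6::nat} = {1, 2, 3, 4, 5, 6}" by auto
  \<comment> \<open>Counting as a sum of indicators lets the six terms be grouped three and
    three.\<close>
  moreover have "card {i \<in> {1..6::nat}. e \<in> M i} = (\<Sum>i\<in>{1..6}. of_bool (e \<in> M i))"
    by (simp add: sum_of_bool_eq Int_def)
  ultimately show ?thesis by (simp add: multiplicity_def)
qed

text \<open>Only multiplicity 3 puts an edge in all three matchings. Testing edges of
  \<open>G\<close> suffices because matchings lie in \<open>edges G\<close>.\<close>

lemma fr_triple_iff:
  "fr_triple G (M1, M2, M3) \<longleftrightarrow>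
     perfect_matching G M1 \<and> perfect_matching G M2 \<and> perfect_matching G M3 \<and>
     (\<forall>e\<in>edges G. multiplicity (M1, M2, M3) e \<le> 2)"
  by (auto simp: fr_triple_def multiplicity_def perfect_matching_def of_bool_def split: if_splits)

text \<open>The bounds matter: multiplicities 1 and 3 satisfy both equivalences behind
  compatibility, yet add up to 4. Within {0, 1, 2} the equivalences leave 1 paired only with
  1.\<close>

lemma compatible_iff:
  assumes "\<And>e. e \<in> edges G \<Longrightarrow> multiplicity T e \<le> 2"
    and "\<And>e. e \<in> edges G \<Longrightarrow> multiplicity T' e \<le> 2"
  shows "compatible G T T' \<longleftrightarrow> (\<forall>e\<in>edges G. multiplicity T e + multiplicity T' e = 2)"
proof -
  have "compatible G T T' \<longleftrightarrow> (\<forall>e\<in>edges G.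
      (multiplicity T e = 0 \<longleftrightarrow> multiplicity T' e = 2) \<and>
      (multiplicity T e = 2 \<longleftrightarrow> multiplicity T' e = 0))"
    unfolding compatible_def covered_exactly_eq by blast
  also have "\<dots> \<longleftrightarrow> (\<forall>e\<in>edges G. multiplicity T e + multiplicity T' e = 2)"
  proof (rule ball_cong[OF refl])
    fix e assume "e \<in> edges G"
    then show "(multiplicity T e = 0 \<longleftrightarrow> multiplicity T' e = 2) \<and>
        (multiplicity T e = 2 \<longleftrightarrow> multiplicity T' e = 0) \<longleftrightarrow>
        multiplicity T e + multiplicity T' e = 2"
      using assms[of e] by linarith
  qed
  finally show ?thesis .
qed

lemma fulkerson_covering_iff_compatible:
  "fulkerson_covering G M \<longleftrightarrow>
     fr_triple G (M 1, M 2, M 3) \<and> fr_triple G (M 4, M 5, M 6) \<and>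
     compatible G (M 1, M 2, M 3) (M 4, M 5, M 6)" (is "_ \<longleftrightarrow> ?fr")
proof -
  have six: "{1..6::nat} = {1, 2, 3, 4, 5, 6}" by auto
  have matchings: "(\<forall>i\<in>{1..6}. perfect_matching G (M i)) \<longleftrightarrow>
      perfect_matching G (M 1) \<and> perfect_matching G (M 2) \<and> perfect_matching G (M 3) \<and>
      perfect_matching G (M 4) \<and> perfect_matching G (M 5) \<and> perfect_matching G (M 6)"
    unfolding six by simp
  have "fulkerson_covering G M \<longleftrightarrow> (\<forall>i\<in>{1..6}. perfect_matching G (M i)) \<and>
      (\<forall>e\<in>edges G. multiplicity (M 1, M 2, M 3) e + multiplicity (M 4, M 5, M 6) e = 2)"
    by (simp only: fulkerson_covering_def card_six_indices)
  also have "\<dots> \<longleftrightarrow> ?fr"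
  proof (cases "\<forall>e\<in>edges G. multiplicity (M 1, M 2, M 3) e \<le> 2 \<and>
      multiplicity (M 4, M 5, M 6) e \<le> 2")
    case True
    then show ?thesis
      unfolding matchings fr_triple_iff by (subst compatible_iff) auto
  next
    \<comment> \<open>Both sides fail: a total of 2 bounds each summand by 2, and so does being an
      FR-triple.\<close>
    case False
    then show ?thesis
      unfolding fr_triple_iff by (metis le_add1 le_add2)
  qed
  finally show ?thesis .
qed

theorem theorem2p5:
  fixes G :: "('v, 'e) mgraph"
  assumes "finite_multigraph G" and "cubic G" and "bridgeless G"
  shows "(\<exists>M. fulkerson_covering G M) \<longleftrightarrow>
    (\<exists>T T'. fr_triple G T \<and> fr_triple G T' \<and> compatible G T T')"
proof
  assume "\<exists>M. fulkerson_covering G M"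
  then show "\<exists>T T'. fr_triple G T \<and> fr_triple G T' \<and> compatible G T T'"
    by (auto simp only: fulkerson_covering_iff_compatible)
next
  assume "\<exists>T T'. fr_triple G T \<and> fr_triple G T' \<and> compatible G T T'"
  then obtain A B C A' B' C' where
    "fr_triple G (A, B, C)" "fr_triple G (A', B', C')" "compatible G (A, B, C) (A', B', C')"
    by (metis prod_cases3)
  \<comment> \<open>List positions start at 0, hence the shift by one; values of the family outside
    1 to 6 are irrelevant.\<close>
  then have "fulkerson_covering G (\<lambda>i. [A, B, C, A', B', C'] ! (i - 1))"
    by (simp add: fulkerson_covering_iff_compatible)
  then show "\<exists>M. fulkerson_covering G M" by blast
qed

end
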